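(* Let $n\ge5$ and $s$ be integers with $1<s<n/2$, let $q=\lfloor n/s\rfloor$ and $r=n-qs$. If $r\le q$ or $r+q\ge s+1$, then $$\pi(C_n(1,s))\ge \frac12\left\lfloor\frac{(s+1)^2}{2}\right\rfloor.$$
   Context: The circulant graph $C_n(1,s)$ has vertex set $\mathbb{Z}_n$, with $i,j$ adjacent iff $i-j\in\{\pm1,\pm s\}$ mod $n$. An all-to-all routing $R$ of a graph $G$ is a set of oriented paths with exactly one path from $x$ to $y$ for each ordered pair of distinct vertices $(x,y)$. The load of an edge under $R$ is the number of paths of $R$ using it (in either direction); $\pi(G,R)$ is the maximum edge load and the edge-forwarding index is $\pi(G)=\min_R\pi(G,R)$ over all all-to-all routings $R$. *)

theory Defs
  imports Complex_Main "HOL-Number_Theory.Cong"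
begin

text \<open>A simple graph is a pair of a vertex set and a set of edges, an edge being
  the two-element set of its ends.\<close>

type_synonym 'a ugraph = "'a set \<times> 'a set set"

abbreviation verts :: "'a ugraph \<Rightarrow> 'a set" where "verts \<equiv> fst"
abbreviation edges :: "'a ugraph \<Rightarrow> 'a set set" where "edges \<equiv> snd"

text \<open>An oriented path is given by its nonempty list of pairwise distinct vertices, in order.\<close>

definition path_edges :: "'a list \<Rightarrow> 'a set set" where
  "path_edges p = {{p ! i, p ! Suc i} | i. Suc i < length p}"

definition is_path :: "'a ugraph \<Rightarrow> 'a list \<Rightarrow> bool" where
  "is_path G p \<longleftrightarrow> p \<noteq> [] \<and> distinct p \<and> set p \<subseteq> verts G \<and> path_edges p \<subseteq> edges G"

definition is_routing :: "'a ugraph \<Rightarrow> 'a list set \<Rightarrow> bool" where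
  "is_routing G R \<longleftrightarrow>
     (\<forall>p\<in>R. is_path G p \<and> hd p \<noteq> last p) \<and>
     (\<forall>x\<in>verts G. \<forall>y\<in>verts G. x \<noteq> y \<longrightarrow> (\<exists>!p. p \<in> R \<and> hd p = x \<and> last p = y))"

definition edge_load :: "'a list set \<Rightarrow> 'a set \<Rightarrow> nat" where
  "edge_load R e = card {p \<in> R. e \<in> path_edges p}"

text \<open>For finite graphs with at least one edge.\<close>

definition max_load :: "'a ugraph \<Rightarrow> 'a list set \<Rightarrow> nat" where
  "max_load G R = Max (edge_load R ` edges G)"

text \<open>The infimum in \<^typ>\<open>nat\<close> is a minimum as soon as a routing exists, i.e. for
  connected graphs; \<open>circulant_routing_exists\<close> below covers the circulant graphs.\<close>

definition edge_forwarding_index :: "'a ugraph \<Rightarrow> nat" where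
  "edge_forwarding_index G = Inf {max_load G R | R. is_routing G R}"

text \<open>\<open>\<int>\<^sub>n\<close> is represented by the residues \<open>0, \<dots>, n - 1\<close>.\<close>

definition circulant :: "int \<Rightarrow> int \<Rightarrow> int ugraph" where
  "circulant n s =
     ({0..<n},
      {{i, j} | i j. i \<in> {0..<n} \<and> j \<in> {0..<n} \<and>
         (\<exists>d\<in>{1, - 1, s, - s}. [i - j = d] (mod n))})"

lemma circulant_path_upto:
  assumes "0 \<le> x" "x \<le> y" "y < n"
  shows "is_path (circulant n s) [x..y]" "is_path (circulant n s) (rev [x..y])"
proof -
  have E: "{i, i + 1} \<in> edges (circulant n s)" if "x \<le> i" "i < y" for i
  proof -
    have "[i - (i + 1) = - 1] (mod n)"
      by simp
    moreover have "i \<in> {0..<n}" "i + 1 \<in> {0..<n}"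
      using that assms by auto
    ultimately show ?thesis
      unfolding circulant_def snd_conv by blast
  qed
  have P: "path_edges [x..y] \<subseteq> edges (circulant n s)"
  proof
    fix e assume "e \<in> path_edges [x..y]"
    then obtain k where k: "Suc k < length [x..y]" "e = {[x..y] ! k, [x..y] ! Suc k}"
      by (auto simp: path_edges_def)
    then have "e = {x + int k, x + int k + 1}"
      by (simp add: nth_upto algebra_simps)
    with k show "e \<in> edges (circulant n s)"
      using E[of "x + int k"] by simp
  qed
  have R: "path_edges (rev p) \<subseteq> path_edges p" for p :: "int list"
  proof
    fix e assume "e \<in> path_edges (rev p)"
    then obtain k where k: "Suc k < length p" "e = {rev p ! k, rev p ! Suc k}"
      by (auto simp: path_edges_def)
    let ?m = "length p - Suc (Suc k)"
    have "e = {p ! ?m, p ! Suc ?m}"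
      using k by (simp add: rev_nth insert_commute Suc_diff_Suc)
    moreover have "Suc ?m < length p"
      using k by simp
    ultimately show "e \<in> path_edges p"
      unfolding path_edges_def by blast
  qed
  have V: "set [x..y] \<subseteq> verts (circulant n s)"
    using assms by (auto simp: circulant_def)
  show "is_path (circulant n s) [x..y]"
    using P V assms by (simp add: is_path_def)
  show "is_path (circulant n s) (rev [x..y])"
    using P V R[of "[x..y]"] assms by (auto simp: is_path_def)
qed

lemma circulant_routing_exists: "\<exists>R. is_routing (circulant n s) R"
proof -
  let ?G = "circulant n s"
  define f where "f x y = (if x \<le> y then [x..y] else rev [y..x])" for x y :: int
  have ends: "hd (f x y) = x" "last (f x y) = y" for x y
    by (auto simp: f_def hd_rev last_rev hd_conv_nth[of "[_.._]"] last_conv_nth[of "[_.._]"])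
  have path: "is_path ?G (f x y)" if "x \<in> verts ?G" "y \<in> verts ?G" for x y
    using that circulant_path_upto[of x y n s] circulant_path_upto[of y x n s]
    by (auto simp: f_def circulant_def)
  define R where "R = {f x y | x y. x \<in> verts ?G \<and> y \<in> verts ?G \<and> x \<noteq> y}"
  have "is_routing ?G R"
    unfolding is_routing_def
  proof (intro conjI ballI impI)
    fix p assume "p \<in> R"
    then show "is_path ?G p" "hd p \<noteq> last p"
      using path ends by (auto simp: R_def)
  next
    fix x y assume "x \<in> verts ?G" "y \<in> verts ?G" "x \<noteq> y"
    then have "f x y \<in> R"
      unfolding R_def by blast
    moreover have "p = f (hd p) (last p)" if "p \<in> R" for p
      using that ends by (auto simp: R_def)
    ultimately show "\<exists>!p. p \<in> R \<and> hd p = x \<and> last p = y"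
      using ends by metis
  qed
  then show ?thesis ..
qed

end

theory Submission imports Defs
begin

text \<open>There are at most \<open>2n\<close> edges, so the index is at least half of the sum \<open>D\<close> of the distances
  from a fixed vertex, and \<open>D\<close> is at least the sum over \<open>k < K\<close> of the number of vertices outside the
  ball of radius \<open>k\<close>. The hypothesis on \<open>r\<close> says that \<open>n = Q s + \<rho>\<close> with \<open>\<rho>\<close> small compared to \<open>Q\<close>,
  where \<open>(Q, \<rho>)\<close> is \<open>(q, r)\<close> or \<open>(q + 1, r - s)\<close>. Then \<open>Q\<close> steps of length \<open>s\<close> are no faster than
  unit steps, so a ball of radius \<open>k\<close> is covered by \<open>Q\<close> intervals of length about \<open>2k\<close>, and
  \<open>D\<close> is at least about \<open>Q\<close> times the sum of the positive numbers \<open>s - 2k\<close>.\<close>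

section \<open>Balls and their sizes\<close>

text \<open>The ball about 0, encoded by signed counts \<open>a\<close> of unit steps and
  \<open>b\<close> of \<open>s\<close>-steps instead of by paths: a displacement mod
  \<open>n\<close> does not depend on the order of the steps.\<close>

definition circ_ball :: "int \<Rightarrow> int \<Rightarrow> int \<Rightarrow> int set" where
  "circ_ball n s k = {d \<in> {0..<n}. \<exists>a b. \<bar>a\<bar> + \<bar>b\<bar> \<le> k \<and> [d = a + s * b] (mod n)}"

text \<open>Write \<open>b = c + Q m\<close>. Since \<open>s Q \<equiv> - \<rho>\<close>, replacing \<open>b\<close> by \<open>c\<close> moves \<open>a\<close> by \<open>- \<rho> m\<close>, which
  costs no more than the \<open>Q \<bar>m\<bar>\<close> steps saved; for \<open>m < 0\<close> one of the \<open>Q\<close>-step turns is kept.\<close>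

lemma circ_ball_decomp:
  fixes n s Q \<rho> a b k :: int
  assumes n: "n = Q * s + \<rho>" and Q: "0 < Q" and \<rho>: "\<bar>\<rho>\<bar> \<le> Q" and ab: "\<bar>a\<bar> + \<bar>b\<bar> \<le> k"
  obtains c t where "0 \<le> c" "c < Q" "\<bar>t\<bar> \<le> k - c \<or> \<bar>t - \<rho>\<bar> \<le> k - (Q - c)"
    "[a + s * b = s * c + t] (mod n)"
proof -
  define c m t where "c = b mod Q" and "m = b div Q" and "t = a - \<rho> * m"
  have b: "b = c + Q * m" and c: "0 \<le> c" "c < Q"
    using Q by (auto simp: c_def m_def)
  have "a + s * b - (s * c + t) = n * m"
    unfolding b t_def n by (simp add: algebra_simps)
  then have cong: "[a + s * b = s * c + t] (mod n)"
    by (simp add: cong_iff_dvd_diff)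
  have "\<bar>t\<bar> \<le> k - c \<or> \<bar>t - \<rho>\<bar> \<le> k - (Q - c)"
  proof (cases "0 \<le> m")
    case True
    have "\<bar>\<rho> * m\<bar> \<le> Q * m"
      using True \<rho> by (simp add: abs_mult mult_right_mono)
    moreover have "0 \<le> Q * m"
      using True Q by simp
    ultimately show ?thesis
      using ab b c unfolding t_def by linarith
  next
    case False
    then have m: "0 \<le> - m - 1"
      by simp
    have "\<bar>\<rho> * (- m - 1)\<bar> \<le> Q * (- m - 1)"
      using m \<rho> by (simp only: abs_mult abs_of_nonneg mult_right_mono)
    moreover have "0 \<le> Q * (- m - 1)"
      using m Q by (simp only: zero_le_mult_iff) simp
    moreover have "t - \<rho> = a + \<rho> * (- m - 1)"
      by (simp add: t_def algebra_simps)
    moreover have "b = - (Q * (- m - 1)) - (Q - c)"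
      by (simp add: b algebra_simps)
    ultimately show ?thesis
      using ab c by linarith
  qed
  then show thesis
    using that c cong by blast
qed

text \<open>The decomposition covers the ball by the translates by \<open>s * c\<close> of sets
  \<open>T c\<close>. The slack \<open>e\<close> measures how much shorter these are for
  \<open>c \<noteq> 0\<close> than for \<open>c = 0\<close>; it is chosen later according to
  \<open>\<rho>\<close>.\<close>

lemma card_circ_ball_le:
  fixes n s Q \<rho> k e :: int
  assumes n: "n = Q * s + \<rho>" "0 < n" and Q: "0 < Q" and \<rho>: "\<bar>\<rho>\<bar> \<le> Q" and k: "0 \<le> k"
    and e: "e \<le> 2" "e \<le> Q - \<bar>\<rho>\<bar>"
  shows "int (card (circ_ball n s k)) \<le> 2 * k + 1 + (Q - 1) * max 0 (2 * k + 1 - e)"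
proof -
  define T where "T c = {t. \<bar>t\<bar> \<le> k - c \<or> \<bar>t - \<rho>\<bar> \<le> k - (Q - c)}" for c
  define lo hi where "lo c = min (c - k) (\<rho> - k + Q - c)" and "hi c = max (k - c) (\<rho> + k - Q + c)" for c
  have T_sub: "T c \<subseteq> {lo c..hi c}" for c
    by (auto simp: T_def lo_def hi_def)
  have fin: "finite (T c)" for c
    using T_sub finite_subset by blast
  have T0: "int (card (T 0)) \<le> 2 * k + 1"
  proof -
    \<comment> \<open>A \<open>t\<close> within \<open>k - Q\<close> of \<open>\<rho>\<close> is
      within \<open>k\<close> of 0, because \<open>\<bar>\<rho>\<bar> \<le> Q\<close>.\<close>
    have "T 0 \<subseteq> {- k..k}"
      using \<rho> by (auto simp: T_def)
    then have "card (T 0) \<le> card {- k..k}"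
      by (intro card_mono) auto
    then show ?thesis
      using k by simp
  qed
  have T1: "int (card (T c)) \<le> max 0 (2 * k + 1 - e)" if "c \<in> {1..<Q}" for c
  proof -
    have "card (T c) \<le> card {lo c..hi c}"
      by (intro card_mono T_sub) auto
    then have "int (card (T c)) \<le> max 0 (hi c - lo c + 1)"
      by auto
    \<comment> \<open>If both ends of the hull come from one interval, the difference is at most
      \<open>2 * k - 2\<close>, as \<open>c\<close> and \<open>Q - c\<close> are at least 1. If they
      come from different ones, it is at most
      \<open>2 * k - (Q - \<bar>\<rho>\<bar>)\<close>.\<close>
    moreover have "hi c - lo c \<le> 2 * k - e"
      using that e by (auto simp: lo_def hi_def)
    ultimately show ?thesis
      by linarith
  qed
  have "circ_ball n s k \<subseteq> (\<lambda>(c, t). (s * c + t) mod n) ` (SIGMA c:{0..<Q}. T c)"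
  proof
    fix d assume "d \<in> circ_ball n s k"
    then obtain a b where d: "0 \<le> d" "d < n" and ab: "\<bar>a\<bar> + \<bar>b\<bar> \<le> k" and "[d = a + s * b] (mod n)"
      by (auto simp: circ_ball_def)
    moreover obtain c t where ct: "0 \<le> c" "c < Q" "t \<in> T c" and "[a + s * b = s * c + t] (mod n)"
      using circ_ball_decomp[OF n(1) Q \<rho> ab] unfolding T_def by blast
    ultimately have "d = (s * c + t) mod n"
      by (metis cong_def mod_pos_pos_trivial)
    with ct show "d \<in> (\<lambda>(c, t). (s * c + t) mod n) ` (SIGMA c:{0..<Q}. T c)"
      by force
  qed
  then have "card (circ_ball n s k) \<le> card (SIGMA c:{0..<Q}. T c)"
    by (intro surj_card_le) (auto simp: fin)
  also have "\<dots> = (\<Sum>c\<in>{0..<Q}. card (T c))"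
    by (simp add: fin)
  also have "{0..<Q} = insert 0 {1..<Q}"
    using Q by auto
  finally have "int (card (circ_ball n s k)) \<le> int (card (T 0)) + (\<Sum>c\<in>{1..<Q}. int (card (T c)))"
    by (simp flip: of_nat_sum)
  also have "(\<Sum>c\<in>{1..<Q}. int (card (T c))) \<le> of_nat (card {1..<Q}) * max 0 (2 * k + 1 - e)"
    by (rule sum_bounded_above) (rule T1)
  also have "of_nat (card {1..<Q}) = Q - 1"
    using Q by simp
  finally show ?thesis
    using T0 by linarith
qed

text \<open>Layer-cake summation: \<open>f y\<close> counts the levels \<open>k < f y\<close>, and
  cutting off at \<open>K\<close> only loses terms.\<close>

lemma sum_ge_card_level_sets:
  fixes f :: "'a \<Rightarrow> nat"
  assumes "finite V"
  shows "(\<Sum>k<K. int (card V) - int (card {y \<in> V. f y \<le> k})) \<le> (\<Sum>y\<in>V. int (f y))"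
proof -
  have "(\<Sum>k<K. int (card V) - int (card {y \<in> V. f y \<le> k})) = (\<Sum>k<K. \<Sum>y\<in>V. of_bool (k < f y))"
  proof (rule sum.cong[OF refl])
    fix k
    have "card ({y \<in> V. f y \<le> k} \<union> {y \<in> V. k < f y}) = card {y \<in> V. f y \<le> k} + card {y \<in> V. k < f y}"
      using assms by (intro card_Un_disjoint) auto
    moreover have "{y \<in> V. f y \<le> k} \<union> {y \<in> V. k < f y} = V"
      by auto
    moreover have "(\<Sum>y\<in>V. of_bool (k < f y)) = int (card {y \<in> V. k < f y})"
      using assms by (simp add: Int_def)
    ultimately show "int (card V) - int (card {y \<in> V. f y \<le> k}) = (\<Sum>y\<in>V. of_bool (k < f y))"
      by simp
  qed
  also have "\<dots> = (\<Sum>y\<in>V. \<Sum>k<K. of_bool (k < f y))"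
    by (rule sum.swap)
  also have "\<dots> \<le> (\<Sum>y\<in>V. int (f y))"
  proof (rule sum_mono)
    fix y
    have "(\<Sum>k<K. of_bool (k < f y)) = int (card ({..<K} \<inter> {..<f y}))"
      by (simp add: Int_def)
    also have "\<dots> \<le> int (card {..<f y})"
      by (intro of_nat_mono card_mono) auto
    finally show "(\<Sum>k<K. of_bool (k < f y)) \<le> int (f y)"
      by simp
  qed
  finally show ?thesis .
qed

section \<open>Edges and paths as displacements\<close>

lemma path_edges_Cons: "path_edges (x # y # p) = insert {x, y} (path_edges (y # p))"
proof -
  have "{i. Suc i < length (x # y # p)} = insert 0 (Suc ` {i. Suc i < length (y # p)})"
    by (auto simp: image_iff gr0_conv_Suc less_Suc_eq_0_disj)
  moreover have "path_edges q = (\<lambda>i. {q ! i, q ! Suc i}) ` {i. Suc i < length q}" for q :: "'a list"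
    by (auto simp: path_edges_def)
  ultimately show ?thesis
    by (simp add: image_image)
qed

lemma path_edges_singleton: "path_edges [x] = {}"
  by (simp add: path_edges_def)

lemma finite_path_edges: "finite (path_edges p)"
proof -
  have "path_edges p = (\<lambda>i. {p ! i, p ! Suc i}) ` {i. Suc i < length p}"
    by (auto simp: path_edges_def)
  moreover have "finite {i. Suc i < length p}"
    by (rule finite_subset[of _ "{..<length p}"]) auto
  ultimately show ?thesis
    by simp
qed

lemma path_edges_subset_set: "e \<in> path_edges p \<Longrightarrow> e \<subseteq> set p"
  by (auto simp: path_edges_def)

lemma circulant_edge_cong:
  assumes "{x, y} \<in> edges (circulant n s)"
  obtains a b where "\<bar>a\<bar> + \<bar>b\<bar> = 1" "[y - x = a + s * b] (mod n)"
proof -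
  obtain i j d where ij: "{x, y} = {i, j}" and d: "d \<in> {1, - 1, s, - s}" "[i - j = d] (mod n)"
    using assms unfolding circulant_def by auto
  have "[j - i = - d] (mod n)"
    using d(2) by (metis cong_minus_minus_iff minus_diff_eq)
  moreover have "x = i \<and> y = j \<or> x = j \<and> y = i"
    using ij by (simp add: doubleton_eq_iff)
  moreover have "- d \<in> {1, - 1, s, - s}"
    using d(1) by auto
  ultimately obtain d' where d': "d' \<in> {1, - 1, s, - s}" "[y - x = d'] (mod n)"
    using d by blast
  then show thesis
    using that[of 1 0] that[of "-1" 0] that[of 0 1] that[of 0 "-1"] by auto
qed

text \<open>Every edge moves by \<open>1\<close>, \<open>- 1\<close>, \<open>s\<close> or
  \<open>- s\<close>, so the counts add up along the path. Length is measured by the number of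
  edges, the quantity that enters the load.\<close>

lemma circulant_path_displacement:
  assumes "p \<noteq> []" "distinct p" "path_edges p \<subseteq> edges (circulant n s)"
  shows "\<exists>a b. \<bar>a\<bar> + \<bar>b\<bar> \<le> int (card (path_edges p)) \<and> [last p - hd p = a + s * b] (mod n)"
  using assms
proof (induction p rule: induct_list012)
  case 1
  then show ?case by simp
next
  case (2 x)
  then show ?case
    by (intro exI[of _ 0]) (simp add: path_edges_singleton)
next
  case (3 x y p)
  obtain a b where ab: "\<bar>a\<bar> + \<bar>b\<bar> \<le> int (card (path_edges (y # p)))"
      "[last (y # p) - y = a + s * b] (mod n)"
    using 3 by (auto simp: path_edges_Cons)
  obtain a' b' where ab': "\<bar>a'\<bar> + \<bar>b'\<bar> = 1" "[y - x = a' + s * b'] (mod n)"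
    using 3 circulant_edge_cong by (metis insert_subset path_edges_Cons)
  \<comment> \<open>The path is distinct, so \<open>x\<close> is not on its remainder and this edge
    is new.\<close>
  have "{x, y} \<notin> path_edges (y # p)"
    using 3 path_edges_subset_set by fastforce
  then have "int (card (path_edges (x # y # p))) = 1 + int (card (path_edges (y # p)))"
    by (simp add: path_edges_Cons finite_path_edges)
  moreover have "[last (x # y # p) - hd (x # y # p) = (a + a') + s * (b + b')] (mod n)"
    using cong_add[OF ab(2) ab'(2)] by (simp add: algebra_simps)
  ultimately show ?case
    using ab(1) ab'(1) by (intro exI[of _ "a + a'"] exI[of _ "b + b'"] conjI) auto
qed

text \<open>Each edge can be oriented so that its difference is \<open>1\<close> or
  \<open>s\<close>; indexing by starting point and difference yields the bound \<open>2 * n\<close>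
  on the number of edges.\<close>

lemma circulant_edges_subset:
  "edges (circulant n s) \<subseteq> (\<lambda>(j, d). {j, (j + d) mod n}) ` ({0..<n} \<times> {1, s})"
proof
  fix e assume "e \<in> edges (circulant n s)"
  then obtain i j d where e: "e = {i, j}" and ij: "i \<in> {0..<n}" "j \<in> {0..<n}"
      and d: "d \<in> {1, - 1, s, - s}" "[i - j = d] (mod n)"
    unfolding circulant_def by auto
  have "i = (j + d) mod n"
    using d(2) ij cong_add[OF cong_refl[of j] d(2)] by (simp add: cong_def)
  moreover have "j = (i + - d) mod n"
    using d(2) ij cong_diff[OF cong_refl[of i] d(2)] by (simp add: cong_def)
  moreover have "d \<in> {1, s} \<or> - d \<in> {1, s}"
    using d by auto
  ultimately consider "e = {j, (j + d) mod n}" "d \<in> {1, s}" | "e = {i, (i + - d) mod n}" "- d \<in> {1, s}"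
    using e by (metis insert_commute)
  then show "e \<in> (\<lambda>(j, d). {j, (j + d) mod n}) ` ({0..<n} \<times> {1, s})"
    by cases (use ij in blast)+
qed

lemma finite_circulant_edges: "finite (edges (circulant n s))"
  by (rule finite_subset[OF circulant_edges_subset]) auto

lemma card_circulant_edges_le:
  assumes "0 \<le> n"
  shows "int (card (edges (circulant n s))) \<le> 2 * n"
proof -
  have "card (edges (circulant n s)) \<le> card ({0..<n} \<times> {1, s})"
    by (rule surj_card_le[OF _ circulant_edges_subset]) auto
  also have "\<dots> \<le> nat n * 2"
    by (auto simp: card_cartesian_product card_insert_if)
  finally show ?thesis
    using assms by linarith
qed

section \<open>Routings and double counting of the load\<close>

lemma finite_routing:
  assumes "is_routing G R" "finite (verts G)"
  shows "finite R"
proof (rule finite_imageD)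
  have ends: "hd p \<in> verts G" "last p \<in> verts G" "hd p \<noteq> last p" if "p \<in> R" for p
    using assms(1) that hd_in_set last_in_set by (fastforce simp: is_routing_def is_path_def)+
  show "finite ((\<lambda>p. (hd p, last p)) ` R)"
    by (rule finite_subset[of _ "verts G \<times> verts G"]) (use ends assms(2) in auto)
  show "inj_on (\<lambda>p. (hd p, last p)) R"
  proof (rule inj_onI)
    fix p p' assume "p \<in> R" "p' \<in> R" "(hd p, last p) = (hd p', last p')"
    then show "p = p'"
      using assms(1) ends[of p] unfolding is_routing_def by (metis prod.inject)
  qed
qed

text \<open>Incidences between paths and edges are counted twice: by paths they give the lengths, by
  edges the loads.\<close>

lemma sum_card_path_edges_le:
  assumes R: "is_routing G R" "finite (verts G)" and E: "finite (edges G)"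
  shows "(\<Sum>p\<in>R. card (path_edges p)) \<le> card (edges G) * max_load G R"
proof -
  have finR: "finite R"
    by (rule finite_routing[OF R])
  have "(\<Sum>p\<in>R. card (path_edges p)) = (\<Sum>p\<in>R. card {e \<in> edges G. e \<in> path_edges p})"
  proof (rule sum.cong[OF refl])
    fix p assume "p \<in> R"
    then have "{e \<in> edges G. e \<in> path_edges p} = path_edges p"
      using R by (auto simp: is_routing_def is_path_def)
    then show "card (path_edges p) = card {e \<in> edges G. e \<in> path_edges p}"
      by simp
  qed
  also have "\<dots> = (\<Sum>e\<in>edges G. edge_load R e)"
    unfolding edge_load_def
    using sum.swap_restrict[OF finR E, of "\<lambda>_ _. 1::nat" "\<lambda>p e. e \<in> path_edges p"] by simp
  also have "\<dots> \<le> of_nat (card (edges G)) * max_load G R"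
    by (rule sum_bounded_above) (auto simp: max_load_def E)
  finally show ?thesis
    by simp
qed

text \<open>A path gives back its pair of ends, so distinct pairs select distinct members of
  \<open>R\<close>.\<close>

lemma routing_sum_over_pairs_le:
  fixes G :: "'a ugraph"
  assumes R: "is_routing G R" "finite (verts G)"
    and P: "\<And>x y. x \<in> verts G \<Longrightarrow> y \<in> verts G \<Longrightarrow> x \<noteq> y \<Longrightarrow> P x y \<in> R \<and> hd (P x y) = x \<and> last (P x y) = y"
  shows "(\<Sum>x\<in>verts G. \<Sum>y\<in>verts G - {x}. w (P x y)) \<le> (\<Sum>p\<in>R. w p :: nat)"
proof -
  let ?S = "SIGMA x:verts G. verts G - {x}"
  have "(\<Sum>x\<in>verts G. \<Sum>y\<in>verts G - {x}. w (P x y)) = (\<Sum>(x, y)\<in>?S. w (P x y))"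
    by (rule sum.Sigma) (use R in auto)
  also have "\<dots> = (\<Sum>z\<in>?S. w (case_prod P z))"
    by (rule sum.cong) auto
  also have "\<dots> = sum w (case_prod P ` ?S)"
  proof (rule sum.reindex[symmetric, unfolded o_def])
    show "inj_on (case_prod P) ?S"
      using P by (intro inj_on_inverseI[where g = "\<lambda>p. (hd p, last p)"]) auto
  qed
  also have "\<dots> \<le> sum w R"
    by (rule sum_mono2) (use P finite_routing[OF R] in auto)
  finally show ?thesis .
qed

text \<open>For every source \<open>x\<close> the routed paths have total length at least
  \<open>?D\<close>, so all paths together have at least \<open>n * ?D\<close>. This total is spread
  over at most \<open>2 * n\<close> edges.\<close>

lemma max_load_circulant_ge:
  assumes R: "is_routing (circulant n s) R" and n: "0 < n"
  shows "(\<Sum>k<K. n - int (card (circ_ball n s (int k)))) \<le> 2 * int (max_load (circulant n s) R)"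
    (is "?D \<le> _")
proof -
  let ?G = "circulant n s"
  have V: "verts ?G = {0..<n}"
    by (simp add: circulant_def)
  define P where "P x y = (THE p. p \<in> R \<and> hd p = x \<and> last p = y)" for x y
  have P: "P x y \<in> R \<and> hd (P x y) = x \<and> last (P x y) = y"
    if "x \<in> verts ?G" "y \<in> verts ?G" "x \<noteq> y" for x y
    unfolding P_def by (rule theI') (use R that in \<open>auto simp: is_routing_def\<close>)
  \<comment> \<open>Length of the routed path, possibly more than the distance. The value 0 on the
    diagonal keeps \<open>x\<close> itself in every level set, as the centre of the ball.\<close>
  define f where "f x y = (if x = y then 0 else card (path_edges (P x y)))" for x y
  have disp: "\<exists>a b. \<bar>a\<bar> + \<bar>b\<bar> \<le> int (f x y) \<and> [y - x = a + s * b] (mod n)"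
    if "x \<in> verts ?G" "y \<in> verts ?G" for x y
  proof (cases "x = y")
    case True
    then show ?thesis
      by (intro exI[of _ 0]) (simp add: f_def)
  next
    case False
    then have "is_path ?G (P x y)"
      using P[OF that] R by (auto simp: is_routing_def)
    then show ?thesis
      using circulant_path_displacement[of "P x y" n s] P[OF that False] False
      by (simp add: is_path_def f_def)
  qed
  have row: "?D \<le> (\<Sum>y\<in>{0..<n}. int (f x y))" if x: "x \<in> {0..<n}" for x
  proof -
    \<comment> \<open>Translation by \<open>- x\<close> is injective mod \<open>n\<close> and moves
      the level set into the ball about 0.\<close>
    have "card {y \<in> {0..<n}. f x y \<le> k} \<le> card (circ_ball n s (int k))" for k
    proof (rule card_inj_on_le)
      show "inj_on (\<lambda>y. (y - x) mod n) {y \<in> {0..<n}. f x y \<le> k}"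
      proof (rule inj_onI)
        fix y z assume yz: "y \<in> {y \<in> {0..<n}. f x y \<le> k}" "z \<in> {y \<in> {0..<n}. f x y \<le> k}"
          and "(y - x) mod n = (z - x) mod n"
        then have "[y - x + x = z - x + x] (mod n)"
          by (intro cong_add) (auto simp: cong_def)
        with yz show "y = z"
          by (simp add: cong_def)
      qed
      show "(\<lambda>y. (y - x) mod n) ` {y \<in> {0..<n}. f x y \<le> k} \<subseteq> circ_ball n s (int k)"
      proof
        fix d assume "d \<in> (\<lambda>y. (y - x) mod n) ` {y \<in> {0..<n}. f x y \<le> k}"
        then obtain y where y: "y \<in> {0..<n}" "f x y \<le> k" and d: "d = (y - x) mod n"
          by blast
        obtain a b where "\<bar>a\<bar> + \<bar>b\<bar> \<le> int (f x y)" "[y - x = a + s * b] (mod n)"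
          using disp[unfolded V, OF x y(1)] by blast
        then have "\<bar>a\<bar> + \<bar>b\<bar> \<le> int k \<and> [d = a + s * b] (mod n)"
          using y(2) by (auto simp: d)
        then show "d \<in> circ_ball n s (int k)"
          using n unfolding circ_ball_def by (auto simp: d)
      qed
      show "finite (circ_ball n s (int k))"
        by (rule finite_subset[of _ "{0..<n}"]) (auto simp: circ_ball_def)
    qed
    then have "?D \<le> (\<Sum>k<K. int (card {0..<n}) - int (card {y \<in> {0..<n}. f x y \<le> k}))"
      using n by (intro sum_mono) simp
    also have "\<dots> \<le> (\<Sum>y\<in>{0..<n}. int (f x y))"
      by (rule sum_ge_card_level_sets) simp
    finally show ?thesis .
  qed
  have "n * ?D = of_nat (card {0..<n}) * ?D"
    using n by simp
  also have "\<dots> \<le> (\<Sum>x\<in>{0..<n}. \<Sum>y\<in>{0..<n}. int (f x y))"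
    by (rule sum_bounded_below) (rule row)
  also have "\<dots> = int (\<Sum>x\<in>verts ?G. \<Sum>y\<in>verts ?G - {x}. card (path_edges (P x y)))"
  proof -
    have "(\<Sum>y\<in>{0..<n}. f x y) = (\<Sum>y\<in>{0..<n} - {x}. card (path_edges (P x y)))" for x
      by (rule sum.mono_neutral_cong_right) (auto simp: f_def)
    then show ?thesis
      by (simp add: V flip: of_nat_sum)
  qed
  also have "\<dots> \<le> int (\<Sum>p\<in>R. card (path_edges p))"
    by (intro of_nat_mono routing_sum_over_pairs_le[OF R _ P]) (simp_all add: V)
  also have "\<dots> \<le> int (card (edges ?G) * max_load ?G R)"
    by (intro of_nat_mono sum_card_path_edges_le[OF R]) (simp_all add: V finite_circulant_edges)
  also have "\<dots> \<le> 2 * n * int (max_load ?G R)"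
    using card_circulant_edges_le[of n s] n by (simp add: mult_right_mono)
  finally have "n * ?D \<le> n * (2 * int (max_load ?G R))"
    by (simp add: mult_ac)
  then show ?thesis
    using n by simp
qed

lemma edge_forwarding_index_circulant_ge:
  assumes "0 < n"
  shows "(\<Sum>k<K. n - int (card (circ_ball n s (int k))))
           \<le> 2 * int (edge_forwarding_index (circulant n s))"
proof -
  have "edge_forwarding_index (circulant n s)
          \<in> {max_load (circulant n s) R | R. is_routing (circulant n s) R}"
    unfolding edge_forwarding_index_def
    using circulant_routing_exists[of n s] by (intro Inf_nat_def1) blast
  then show ?thesis
    using max_load_circulant_ge[OF _ assms] by auto
qed

section \<open>The quadratic bound\<close>

lemma sum_diff_double: "(\<Sum>k<K. s - 2 * int k) = int K * (s + 1 - int K)"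
  by (induction K) (simp_all add: algebra_simps)

text \<open>\<open>K\<close> is chosen so that \<open>k < K\<close> holds exactly when
  \<open>s - 2 * int k\<close> is positive. Up to a correction at \<open>k = 0\<close>, level
  \<open>k\<close> contributes at least \<open>Q\<close> times this number, and \<open>Q\<close> is
  large enough to reach \<open>2 * ?F\<close>.\<close>

lemma edge_forwarding_index_circulant_ge_quad:
  fixes n s Q \<rho> :: int
  assumes n: "n = Q * s + \<rho>" "0 < n" and s: "1 < s"
    and Q: "1 \<le> \<rho> \<and> \<rho> \<le> Q \<and> 2 \<le> Q \<or> \<rho> \<le> 0 \<and> 2 - Q \<le> \<rho> \<and> 3 \<le> Q"
    and K: "K = nat ((s + 1) div 2)"
  shows "int K * (s + 1 - int K) \<le> int (edge_forwarding_index (circulant n s))"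
proof -
  let ?F = "int K * (s + 1 - int K)"
  define N where "N k = int (card (circ_ball n s (int k)))" for k
  have index: "(\<Sum>k<K. n - N k) \<le> 2 * int (edge_forwarding_index (circulant n s))"
    unfolding N_def by (rule edge_forwarding_index_circulant_ge[OF n(2)])
  have N: "N k \<le> 2 * int k + 1 + (Q - 1) * max 0 (2 * int k + 1 - e)"
    if "e \<le> 2" "e \<le> Q - \<bar>\<rho>\<bar>" for k e
    unfolding N_def by (rule card_circ_ball_le[OF n]) (use Q that in auto)
  have sum_Q: "(\<Sum>k<K. Q * (s - 2 * int k)) = Q * ?F"
    by (simp only: sum_diff_double flip: sum_distrib_left)
  have K1: "1 \<le> int K" "int K \<le> s + 1 - int K"
    using s K by auto
  have F: "2 \<le> ?F"
  proof -
    have "1 * 2 \<le> ?F"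
      by (rule mult_mono) (use K1 s K in auto)
    then show ?thesis by simp
  qed
  have "2 * ?F \<le> (\<Sum>k<K. n - N k)"
  proof (cases "1 \<le> \<rho>")
    case True
    \<comment> \<open>If \<open>\<rho> = Q\<close>, take \<open>e = 0\<close>: the surplus
      \<open>Q\<close> in \<open>n\<close> pays for \<open>N k \<le> Q * (2 * int k + 1)\<close>.
      Otherwise \<open>e = 1\<close> gives \<open>N k \<le> 2 * Q * int k + 1\<close>, and
      \<open>\<rho> \<ge> 1\<close> pays for the extra point.\<close>
    have "Q * (s - 2 * int k) \<le> n - N k" for k
      using N[of 0 k] N[of 1 k] Q True
      by (cases "\<rho> = Q") (auto simp: n(1) algebra_simps)
    then have "(\<Sum>k<K. Q * (s - 2 * int k)) \<le> (\<Sum>k<K. n - N k)"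
      by (intro sum_mono)
    moreover have "2 * ?F \<le> Q * ?F"
      by (rule mult_right_mono) (use Q True F in auto)
    ultimately show ?thesis
      unfolding sum_Q by simp
  next
    case False
    \<comment> \<open>For \<open>k = 0\<close> the ball is a single point, not \<open>2 - Q\<close> of them; \<open>Q \<ge> 3\<close> absorbs the loss.\<close>
    have "Q * (s - 2 * int k) - (if k = 0 then Q - 1 else 0) \<le> n - N k" for k
      using N[of 2 k] Q False by (cases "k = 0") (auto simp: n(1) algebra_simps)
    then have "(\<Sum>k<K. Q * (s - 2 * int k) - (if k = 0 then Q - 1 else 0)) \<le> (\<Sum>k<K. n - N k)"
      by (intro sum_mono)
    moreover have "(\<Sum>k<K. Q * (s - 2 * int k) - (if k = 0 then Q - 1 else 0)) = Q * ?F - (Q - 1)"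
      using K1 by (subst sum_subtractf, subst sum_Q) simp
    \<comment> \<open>Rewrite \<open>Q * ?F - (Q - 1)\<close> as \<open>Q * (?F - 1) + 1\<close>;
      this is at least \<open>3 * ?F - 2\<close>, hence at least \<open>2 * ?F\<close> since
      \<open>?F \<ge> 2\<close>.\<close>
    moreover have "3 * (?F - 1) \<le> Q * (?F - 1)"
      by (rule mult_right_mono) (use Q False F in auto)
    ultimately show ?thesis
      using F by (simp add: algebra_simps)
  qed
  with index show ?thesis
    by linarith
qed

section \<open>Choice of \<open>Q\<close> and \<open>\<rho>\<close>, and rounding\<close>

theorem theorem1p3:
  fixes n s q r :: int
  assumes "n \<ge> 5" and "1 < s" and "real_of_int s < real_of_int n / 2"
    and "q = \<lfloor>real_of_int n / real_of_int s\<rfloor>" and "r = n - q * s"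
    and "r \<le> q \<or> r + q \<ge> s + 1"
  shows "real (edge_forwarding_index (circulant n s))
           \<ge> 1 / 2 * real_of_int \<lfloor>(real_of_int s + 1)\<^sup>2 / 2\<rfloor>"
proof -
  have n: "2 * s < n" "0 < n"
    using assms(1,3) by linarith+
  have q: "q = n div s"
    using assms(4) by (simp add: floor_divide_of_int_eq)
  then have r: "n = q * s + r" "0 \<le> r" "r < s"
    using assms(2,5) by (auto simp: minus_div_mult_eq_mod)
  have "\<not> q \<le> 1"
  proof
    assume "q \<le> 1"
    then have "q * s \<le> 1 * s"
      using assms(2) by (intro mult_right_mono) auto
    then show False
      using n r by linarith
  qed
  then have q2: "2 \<le> q"
    by simp
  obtain Q \<rho> where Q\<rho>: "n = Q * s + \<rho>"
      "1 \<le> \<rho> \<and> \<rho> \<le> Q \<and> 2 \<le> Q \<or> \<rho> \<le> 0 \<and> 2 - Q \<le> \<rho> \<and> 3 \<le> Q"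
  proof (cases "r \<le> q")
    case True
    \<comment> \<open>For \<open>r = 0\<close> the second alternative demands
      \<open>q \<ge> 3\<close>; \<open>n > 2 * s\<close> rules out \<open>q = 2\<close>.\<close>
    moreover have "q \<noteq> 2" if "r = 0"
      using that n r by auto
    ultimately have "1 \<le> r \<and> r \<le> q \<and> 2 \<le> q \<or> r \<le> 0 \<and> 2 - q \<le> r \<and> 3 \<le> q"
      using q2 r(2) by linarith
    with r(1) show ?thesis
      by (rule that)
  next
    case False
    \<comment> \<open>With \<open>Q = q + 1\<close> and \<open>\<rho> = r - s\<close>, the condition
      \<open>2 - Q \<le> \<rho>\<close> is exactly \<open>r + q \<ge> s + 1\<close>.\<close>
    then have "r - s \<le> 0 \<and> 2 - (q + 1) \<le> r - s \<and> 3 \<le> q + 1"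
      using q2 r(3) assms(6) by linarith
    moreover have "n = (q + 1) * s + (r - s)"
      using r(1) by (simp add: algebra_simps)
    ultimately show ?thesis
      using that by blast
  qed
  have "int (nat ((s + 1) div 2)) * (s + 1 - int (nat ((s + 1) div 2)))
      \<le> int (edge_forwarding_index (circulant n s))"
    by (rule edge_forwarding_index_circulant_ge_quad[OF Q\<rho>(1) n(2) assms(2) Q\<rho>(2) refl])
  \<comment> \<open>The two factors are \<open>s + 1\<close> halved, rounded down and up. For either
    parity both sides are in fact equal, so rounding loses nothing.\<close>
  moreover have "(s + 1)\<^sup>2 div 2 \<le> 2 * (int (nat ((s + 1) div 2)) * (s + 1 - int (nat ((s + 1) div 2))))"
  proof (cases "even (s + 1)")
    case True
    then obtain m where "s + 1 = 2 * m" ..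
    then show ?thesis
      using assms(2) by (simp add: power2_eq_square)
  next
    case False
    then obtain m where m: "s + 1 = 2 * m + 1"
      by (rule oddE)
    have "(2 * m + 1)\<^sup>2 = 2 * (2 * m * (m + 1)) + 1"
      by (simp add: power2_eq_square algebra_simps)
    then have "(2 * m + 1)\<^sup>2 div 2 = 2 * m * (m + 1)"
      by presburger
    then show ?thesis
      using assms(2) m by (simp add: algebra_simps)
  qed
  ultimately have "(s + 1)\<^sup>2 div 2 \<le> 2 * int (edge_forwarding_index (circulant n s))"
    by linarith
  moreover have "\<lfloor>(real_of_int s + 1)\<^sup>2 / 2\<rfloor> = (s + 1)\<^sup>2 div 2"
    using floor_divide_of_int_eq[of "(s + 1)\<^sup>2" 2, where ?'a = real] by simp
  ultimately show ?thesis
    by linarith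
qed

end
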